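(* The graphs $T_1$ and $T_2$ are not word-representable, where both have vertex set $\{1,\dots,9\}$ and contain the edges of the $3\times 3$ grid graph $\{1,2\},\{2,3\},\{4,5\},\{5,6\},\{7,8\},\{8,9\},\{1,4\},\{4,7\},\{2,5\},\{5,8\},\{3,6\},\{6,9\}$, and in addition $T_1$ has the edges $\{5,7\},\{2,4\},\{6,8\},\{2,6\}$, while $T_2$ has the edges $\{4,8\},\{1,5\},\{5,9\},\{3,5\}$.
   Context: Vertices $1,\dots,9$ are positions in a $3\times 3$ array, rows $1,2,3$ / $4,5,6$ / $7,8,9$ from top to bottom, each read left to right; the additional edges are one diagonal in each of the four unit squares, so $T_1,T_2$ are triangulations of the $3\times3$ grid graph. A graph $G=(V,E)$ is word-representable if there is a word $w$ over the alphabet $V$ such that for all distinct $x,y\in V$, the letters $x$ and $y$ alternate in $w$ if and only if $\{x,y\}\in E$. *)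

theory Defs
  imports Main
begin

type_synonym 'a graph = "'a set \<times> 'a set set"

text \<open>The words \<open>xyxy...\<close> of any (even or odd) length \<open>n\<close>, starting with \<open>x\<close>.\<close>

definition alternating_word :: "'a \<Rightarrow> 'a \<Rightarrow> nat \<Rightarrow> 'a list" where
  "alternating_word x y n = map (\<lambda>i. if even i then x else y) [0..<n]"

definition alternate :: "'a \<Rightarrow> 'a \<Rightarrow> 'a list \<Rightarrow> bool" where
  "alternate x y w \<longleftrightarrow>
     (\<exists>n. filter (\<lambda>z. z = x \<or> z = y) w = alternating_word x y n \<or>
          filter (\<lambda>z. z = x \<or> z = y) w = alternating_word y x n)"

text \<open>Some authors also require every vertex to occur in \<open>w\<close>. This gives the same graphs: a
  vertex missing from \<open>w\<close> alternates exactly with the letters occurring at most once, and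
  prepending each missing vertex once to \<open>w\<close> does not change which pairs alternate.\<close>

definition word_representable :: "'a graph \<Rightarrow> bool" where
  "word_representable G \<longleftrightarrow>
     (\<exists>w. set w \<subseteq> fst G \<and>
          (\<forall>x\<in>fst G. \<forall>y\<in>fst G. x \<noteq> y \<longrightarrow> (alternate x y w \<longleftrightarrow> {x, y} \<in> snd G)))"

definition grid_edges :: "nat set set" where
  "grid_edges = {{1,2}, {2,3}, {4,5}, {5,6}, {7,8}, {8,9},
                 {1,4}, {4,7}, {2,5}, {5,8}, {3,6}, {6,9}}"

definition T1 :: "nat graph" where
  "T1 = ({1..9}, grid_edges \<union> {{5,7}, {2,4}, {6,8}, {2,6}})"

definition T2 :: "nat graph" where
  "T2 = ({1..9}, grid_edges \<union> {{4,8}, {1,5}, {5,9}, {3,5}})"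

end

theory Submission
  imports Defs
begin

text \<open>
  Both graphs contain an induced wheel with hub 5 and odd rim: 2-4-7-8-6 in the first graph and
  1-2-3-6-9-8-4 in the second. If a word contains every letter, then three pairwise alternating
  letters \<open>v\<close>, \<open>a\<close>, \<open>b\<close> occur in it either in the cyclic order \<open>vab\<close> or in the cyclic order \<open>vba\<close>,
  but not both; for a fixed hub \<open>v\<close> this orients the edges \<open>ab\<close> of the rim. If \<open>a\<close> precedes \<open>b\<close> and
  \<open>b\<close> precedes \<open>c\<close> in this sense, then \<open>a\<close> and \<open>c\<close> alternate. Hence consecutive rim edges of an
  induced wheel are oppositely oriented, so the rim has even length.
\<close>

section \<open>Alternation as the absence of equal neighbours\<close>

lemma alternating_word_Suc: "alternating_word x y (Suc n) = x # alternating_word y x n"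
  unfolding alternating_word_def upt_conv_Cons[OF zero_less_Suc] map_Suc_upt[symmetric]
  by (simp add: comp_def)

lemma distinct_adj_alternating_word:
  assumes "x \<noteq> y"
  shows "distinct_adj (alternating_word x y n)"
  using assms
proof (induction n arbitrary: x y)
  case 0
  then show ?case by (simp add: alternating_word_def)
next
  case (Suc n)
  then show ?case
    by (cases n) (auto simp: alternating_word_Suc alternating_word_def[of _ _ 0])
qed

lemma distinct_adj_imp_alternating_word:
  assumes "distinct_adj u" "set u \<subseteq> {x, y}"
  shows "\<exists>n. u = alternating_word x y n \<or> u = alternating_word y x n"
  using assms
proof (induction u)
  case Nil
  show ?case by (rule exI[of _ 0]) (simp add: alternating_word_def)
next
  case (Cons p u)
  show ?case
  proof (cases u)
    case Nil
    with Cons.prems show ?thesis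
      by (intro exI[of _ "Suc 0"]) (auto simp: alternating_word_def)
  next
    case u: (Cons q u')
    from Cons.prems u have "p \<noteq> q" "{p, q} = {x, y}" by auto
    moreover obtain n where n: "u = alternating_word x y n \<or> u = alternating_word y x n"
      using Cons.IH Cons.prems u by auto
    moreover obtain m where "n = Suc m"
      using n u by (cases n) (auto simp: alternating_word_def)
    ultimately show ?thesis
      using u
      by (intro exI[of _ "Suc n"]) (auto simp: alternating_word_Suc doubleton_eq_iff)
  qed
qed

text \<open>Over two letters, a list without equal neighbours is determined by its first letter and
  its length. The existential over explicit words thus becomes a local condition, which behaves well
  under splitting a word.\<close>

lemma alternate_iff_distinct_adj:
  assumes "x \<noteq> y"
  shows "alternate x y w \<longleftrightarrow> distinct_adj (filter (\<lambda>z. z = x \<or> z = y) w)"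
proof
  assume "alternate x y w"
  then show "distinct_adj (filter (\<lambda>z. z = x \<or> z = y) w)"
    unfolding alternate_def
    using assms distinct_adj_alternating_word[of x y] distinct_adj_alternating_word[of y x]
    by auto
next
  assume "distinct_adj (filter (\<lambda>z. z = x \<or> z = y) w)"
  from distinct_adj_imp_alternating_word[OF this, of x y]
  show "alternate x y w" unfolding alternate_def by auto
qed

lemma alternate_commute: "alternate x y w \<longleftrightarrow> alternate y x w"
proof -
  have "(\<lambda>z. z = x \<or> z = y) = (\<lambda>z. z = y \<or> z = x)" by auto
  then show ?thesis unfolding alternate_def by auto
qed

section \<open>Completing a word to the full alphabet\<close>

lemma alternate_Cons_new:
  assumes "x \<noteq> y" "p \<notin> set w"
  shows "alternate x y (p # w) \<longleftrightarrow> alternate x y w"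
proof -
  let ?u = "filter (\<lambda>z. z = x \<or> z = y) w"
  have "distinct_adj (p # ?u) \<longleftrightarrow> distinct_adj ?u"
  proof (cases ?u)
    case (Cons q u)
    then have "q \<in> set ?u" by simp
    then have "p \<noteq> q" using assms(2) by auto
    with Cons show ?thesis by simp
  qed simp
  with assms(1) show ?thesis by (simp add: alternate_iff_distinct_adj)
qed

lemma alternate_append_new:
  assumes "x \<noteq> y" "distinct ms" "set ms \<inter> set w = {}"
  shows "alternate x y (ms @ w) \<longleftrightarrow> alternate x y w"
  using assms by (induction ms) (auto simp: alternate_Cons_new)

text \<open>Prepending the missing letters once each preserves all alternations. Full support is
  what later makes the two cyclic orders exclusive.\<close>

lemma word_representable_all_letters:
  assumes "word_representable G" "finite (fst G)"
  obtains w where "set w = fst G"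
    "\<And>x y. \<lbrakk>x \<in> fst G; y \<in> fst G; x \<noteq> y\<rbrakk> \<Longrightarrow> alternate x y w \<longleftrightarrow> {x, y} \<in> snd G"
proof -
  obtain w where w: "set w \<subseteq> fst G"
    "\<And>x y. \<lbrakk>x \<in> fst G; y \<in> fst G; x \<noteq> y\<rbrakk> \<Longrightarrow> alternate x y w \<longleftrightarrow> {x, y} \<in> snd G"
    using assms(1) unfolding word_representable_def by blast
  obtain ms where ms: "set ms = fst G - set w" "distinct ms"
    using finite_distinct_list[of "fst G - set w"] assms(2) by auto
  show thesis
  proof
    show "set (ms @ w) = fst G" using w(1) ms(1) by auto
    show "alternate x y (ms @ w) \<longleftrightarrow> {x, y} \<in> snd G"
      if "x \<in> fst G" "y \<in> fst G" "x \<noteq> y" for x y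
      using alternate_append_new[OF that(3) ms(2), of w] ms(1) w(2)[OF that] by auto
  qed
qed

section \<open>Cyclic orders of three letters\<close>

definition cyclic_succ :: "'a \<Rightarrow> 'a \<Rightarrow> 'a \<Rightarrow> 'a \<Rightarrow> 'a \<Rightarrow> bool" where
  "cyclic_succ v a b p q \<longleftrightarrow> (p, q) \<in> {(v, a), (a, b), (b, v)}"

text \<open>The restriction to the three letters is a factor of the periodic word
  \<open>vabvab...\<close>, possibly starting or ending in mid-period.\<close>

definition cyclically_ordered :: "'a \<Rightarrow> 'a \<Rightarrow> 'a \<Rightarrow> 'a list \<Rightarrow> bool" where
  "cyclically_ordered v a b w \<longleftrightarrow>
     successively (cyclic_succ v a b) (filter (\<lambda>z. z = v \<or> z = a \<or> z = b) w)"

text \<open>Any three consecutive letters are distinct, so two neighbours determine the letter in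
  front of them, and the direction of the tail extends to the whole list.\<close>

lemma successively_cyclic_succ_total:
  assumes "v \<noteq> a" "v \<noteq> b" "a \<noteq> b" "set u \<subseteq> {v, a, b}"
    "distinct_adj (filter (\<lambda>z. z = v \<or> z = a) u)"
    "distinct_adj (filter (\<lambda>z. z = v \<or> z = b) u)"
    "distinct_adj (filter (\<lambda>z. z = a \<or> z = b) u)"
  shows "successively (cyclic_succ v a b) u \<or> successively (cyclic_succ v b a) u"
  using assms(4-7)
proof (induction u rule: induct_list012)
  case (3 x y u)
  have IH: "successively (cyclic_succ v a b) (y # u) \<or> successively (cyclic_succ v b a) (y # u)"
  proof (rule "3.IH"(2))
    have tail: "distinct_adj (filter Q l)" if "distinct_adj (filter Q (x # l))" for Q l
      using that by (cases "Q x") (auto simp: distinct_adj_Cons)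
    show "set (y # u) \<subseteq> {v, a, b}" using "3.prems"(1) by simp
    show "distinct_adj (filter (\<lambda>z. z = v \<or> z = a) (y # u))"
      "distinct_adj (filter (\<lambda>z. z = v \<or> z = b) (y # u))"
      "distinct_adj (filter (\<lambda>z. z = a \<or> z = b) (y # u))"
      using "3.prems"(2-4) tail by blast+
  qed
  have xy: "x \<in> {v, a, b}" "y \<in> {v, a, b}" using "3.prems"(1) by simp_all
  have "x \<noteq> y" using xy "3.prems"(2-4) by (elim insertE) simp_all
  show ?case
  proof (cases u)
    case Nil
    with xy \<open>x \<noteq> y\<close> show ?thesis by (auto simp: cyclic_succ_def)
  next
    case (Cons z u')
    have z: "z \<in> {v, a, b}" using "3.prems"(1) Cons by simp
    have "y \<noteq> z" using IH Cons assms(1-3) by (auto simp: cyclic_succ_def)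
    \<comment> \<open>In a factor \<open>x y x\<close>, restricting to \<open>x\<close> and the
      letter other than \<open>x\<close> and \<open>y\<close> drops the middle and leaves two equal
      neighbours.\<close>
    have "x \<noteq> z"
    proof
      assume "x = z"
      then have "x # y # u = x # y # x # u'" using Cons by simp
      with "3.prems"(2-4) xy \<open>x \<noteq> y\<close> assms(1-3) show False
        by (elim insertE) simp_all
    qed
    with IH Cons xy z \<open>x \<noteq> y\<close> \<open>y \<noteq> z\<close> assms(1-3) show ?thesis
      by (elim insertE) (simp_all add: cyclic_succ_def)
  qed
qed auto

lemma cyclically_ordered_total:
  assumes "v \<noteq> a" "v \<noteq> b" "a \<noteq> b" "alternate v a w" "alternate v b w" "alternate a b w"
  shows "cyclically_ordered v a b w \<or> cyclically_ordered v b a w"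
proof -
  let ?u = "filter (\<lambda>z. z = v \<or> z = a \<or> z = b) w"
  have sub: "filter (\<lambda>z. z = p \<or> z = q) ?u = filter (\<lambda>z. z = p \<or> z = q) w"
    if "{p, q} \<subseteq> {v, a, b}" for p q
    using that by (auto intro!: filter_cong)
  have "successively (cyclic_succ v a b) ?u \<or> successively (cyclic_succ v b a) ?u"
    using assms by (intro successively_cyclic_succ_total)
      (auto simp: sub alternate_iff_distinct_adj simp del: filter_filter)
  moreover have "?u = filter (\<lambda>z. z = v \<or> z = b \<or> z = a) w" by (auto intro: filter_cong)
  ultimately show ?thesis unfolding cyclically_ordered_def by auto
qed

lemma cyclically_ordered_asym:
  assumes "v \<noteq> a" "v \<noteq> b" "a \<noteq> b" "v \<in> set w" "a \<in> set w"
    "cyclically_ordered v a b w"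
  shows "\<not> cyclically_ordered v b a w"
proof
  let ?u = "filter (\<lambda>z. z = v \<or> z = a \<or> z = b) w"
  assume "cyclically_ordered v b a w"
  moreover have "?u = filter (\<lambda>z. z = v \<or> z = b \<or> z = a) w" by (auto intro: filter_cong)
  ultimately have u: "successively (cyclic_succ v a b) ?u" "successively (cyclic_succ v b a) ?u"
    using assms(6) unfolding cyclically_ordered_def by auto
  have "{v, a} \<subseteq> set ?u" using assms by auto
  \<comment> \<open>\<open>remdups_adj.cases\<close> serves as a split into lengths 0, 1 and at
    least 2. Two occurring letters give a neighbouring pair, and no pair of letters is a successor
    pair for both directions.\<close>
  then obtain p q us where "?u = p # q # us"
    using assms(1) by (cases ?u rule: remdups_adj.cases) auto
  with u assms(1-3) show False by (auto simp: cyclic_succ_def)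
qed

section \<open>Composing cyclic orders around the hub\<close>

lemma filter_eq_appendE:
  assumes "filter P w = us @ vs"
  obtains xs ys where "w = xs @ ys" "filter P xs = us" "filter P ys = vs"
proof -
  have "\<exists>xs ys. w = xs @ ys \<and> filter P xs = us \<and> filter P ys = vs"
    using assms
  proof (induction us arbitrary: w)
    case Nil
    then show ?case by (intro exI[of _ "[]"] exI[of _ w]) simp
  next
    case (Cons p us)
    then obtain as bs where w: "w = as @ p # bs" "\<forall>z\<in>set as. \<not> P z" "P p" "filter P bs = us @ vs"
      by (auto simp: filter_eq_Cons_iff)
    with Cons.IH obtain xs ys where "bs = xs @ ys" "filter P xs = us" "filter P ys = vs"
      by blast
    with w show ?case by (intro exI[of _ "as @ p # xs"] exI[of _ ys]) simp
  qed
  with that show thesis by blast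
qed

lemma not_distinct_adj_filterE:
  assumes "\<not> distinct_adj (filter P w)"
  obtains xs ys zs p where "w = xs @ p # ys @ p # zs" "P p" "\<forall>y\<in>set ys. \<not> P y"
proof -
  obtain us vs p where "filter P w = us @ p # p # vs"
    using assms unfolding distinct_adj_def successively_conv_nth
    by (metis Cons_nth_drop_Suc Suc_lessD id_take_nth_drop)
  then obtain xs w' where "w = xs @ w'" "filter P w' = p # p # vs"
    by (rule filter_eq_appendE)
  moreover from this(2) obtain as bs
    where "w' = as @ p # bs" "P p" "p # vs = filter P bs"
    unfolding filter_eq_Cons_iff by blast
  moreover from this(3) obtain ys zs where "bs = ys @ p # zs" "\<forall>y\<in>set ys. \<not> P y"
    unfolding Cons_eq_filter_iff by blast
  ultimately show thesis
    by (intro that[of "xs @ as" p ys zs]) simp_all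
qed

text \<open>Otherwise some \<open>a\<close> or \<open>c\<close> repeats with neither letter in
  between. Two such \<open>a\<close> enclose \<open>b v\<close> by the first order, but the second
  demands \<open>c\<close> after \<open>b\<close>. Two such \<open>c\<close> enclose
  \<open>v b\<close> by the second, but the first demands \<open>a\<close> after
  \<open>v\<close>.\<close>

lemma cyclically_ordered_imp_alternate:
  assumes "distinct [v, a, b, c]" "cyclically_ordered v a b w" "cyclically_ordered v b c w"
  shows "alternate a c w"
proof (rule ccontr)
  assume "\<not> alternate a c w"
  then have "\<not> distinct_adj (filter (\<lambda>z. z = a \<or> z = c) w)"
    using assms(1) by (simp add: alternate_iff_distinct_adj)
  then obtain xs ys zs p where w: "w = xs @ p # ys @ p # zs" "p = a \<or> p = c"
    "\<forall>y\<in>set ys. \<not> (y = a \<or> y = c)"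
    by (rule not_distinct_adj_filterE)
  \<comment> \<open>The gap \<open>ys\<close> contains neither \<open>a\<close> nor
    \<open>c\<close>, so both three-letter restrictions agree on it.\<close>
  let ?g = "filter (\<lambda>z. z = v \<or> z = b) ys"
  have ys: "filter (\<lambda>z. z = v \<or> z = a \<or> z = b) ys = ?g"
    "filter (\<lambda>z. z = v \<or> z = b \<or> z = c) ys = ?g"
    using w(3) by (auto intro!: filter_cong)
  have sab: "successively (cyclic_succ v a b) ?g" and sbc: "successively (cyclic_succ v b c) ?g"
    using assms(2,3) unfolding cyclically_ordered_def w(1)
    by (auto simp: ys successively_append_iff successively_Cons split: if_splits)
  have inner: "successively R (p # us @ [p])" if "successively R (ps @ p # us @ p # qs)"
    for R ps us qs
    using that by (auto simp: successively_append_iff successively_Cons hd_append split: if_splits)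
  show False
  proof (cases "p = a")
    case True
    then have "successively (cyclic_succ v a b) (a # ?g @ [a])"
      using assms(2) inner unfolding cyclically_ordered_def w(1) by (simp add: ys)
    with sbc assms(1) show False
      by (cases ?g rule: remdups_adj.cases) (auto simp: cyclic_succ_def)
  next
    case False
    then have "successively (cyclic_succ v b c) (c # ?g @ [c])"
      using assms(3) w(2) inner unfolding cyclically_ordered_def w(1) by (simp add: ys)
    with sab assms(1) show False
      by (cases ?g rule: remdups_adj.cases) (auto simp: cyclic_succ_def)
  qed
qed

section \<open>Odd wheels\<close>

text \<open>The rim is an infinite sequence of period \<open>n\<close>, so that closing the cycle
  needs no separate case.\<close>

theorem odd_wheel_not_word_representable:
  fixes G :: "'a graph" and r :: "nat \<Rightarrow> 'a"
  assumes fin: "finite (fst G)" and hub: "v \<in> fst G" and rim: "\<And>i. r i \<in> fst G - {v}"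
    and spokes: "\<And>i. {v, r i} \<in> snd G"
    and rim_edges: "\<And>i. r i \<noteq> r (Suc i)" "\<And>i. {r i, r (Suc i)} \<in> snd G"
    and induced: "\<And>i. r i \<noteq> r (Suc (Suc i))" "\<And>i. {r i, r (Suc (Suc i))} \<notin> snd G"
    and period: "r n = r 0" "r (Suc n) = r 1" and "odd n"
  shows "\<not> word_representable G"
proof
  assume "word_representable G"
  then obtain w where w: "set w = fst G"
    "\<And>x y. \<lbrakk>x \<in> fst G; y \<in> fst G; x \<noteq> y\<rbrakk> \<Longrightarrow> alternate x y w \<longleftrightarrow> {x, y} \<in> snd G"
    using word_representable_all_letters fin by blast
  define s where "s i \<longleftrightarrow> cyclically_ordered v (r i) (r (Suc i)) w" for i
  have rev: "cyclically_ordered v (r (Suc i)) (r i) w \<longleftrightarrow> \<not> s i" for i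
  proof -
    have "alternate v (r i) w" "alternate v (r (Suc i)) w" "alternate (r i) (r (Suc i)) w"
      using w(2) hub rim spokes rim_edges by (metis Diff_iff singletonI)+
    then have "s i \<or> cyclically_ordered v (r (Suc i)) (r i) w"
      unfolding s_def using rim rim_edges(1) by (intro cyclically_ordered_total) auto
    moreover have "\<not> cyclically_ordered v (r (Suc i)) (r i) w" if "s i"
      using that rim rim_edges(1) hub w(1) unfolding s_def
      by (intro cyclically_ordered_asym) auto
    ultimately show ?thesis by blast
  qed
  \<comment> \<open>Two edges oriented forwards compose to an alternation of \<open>r i\<close> and
    \<open>r (Suc (Suc i))\<close>. Two oriented backwards do the same when read in reverse, hence
    both versions of each fact.\<close>
  have flip: "s (Suc i) \<longleftrightarrow> \<not> s i" for i
  proof -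
    have "\<not> alternate (r i) (r (Suc (Suc i))) w" "\<not> alternate (r (Suc (Suc i))) (r i) w"
      using w(2) rim induced alternate_commute by (metis DiffD1)+
    moreover have "distinct [v, r i, r (Suc i), r (Suc (Suc i))]"
      "distinct [v, r (Suc (Suc i)), r (Suc i), r i]"
      using rim rim_edges(1) induced(1) by (auto simp: eq_commute)
    ultimately show ?thesis
      using cyclically_ordered_imp_alternate rev s_def by metis
  qed
  have "s i \<longleftrightarrow> (even i \<longleftrightarrow> s 0)" for i
    by (induction i) (auto simp: flip)
  \<comment> \<open>The edge with index \<open>n\<close> has ends \<open>r n\<close> and
    \<open>r (Suc n)\<close>, hence two period equations.\<close>
  moreover have "s n = s 0" using period by (simp add: s_def)
  ultimately show False using \<open>odd n\<close> by blast
qed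

text \<open>With the rim as a list, concrete instances reduce to finite checks: zipping with one or
  two rotations lists the pairs at cyclic distance one or two.\<close>

corollary odd_wheel_list_not_word_representable:
  assumes "finite (fst G)" "v \<in> fst G" "odd (length xs)" "set xs \<subseteq> fst G - {v}"
    and "\<forall>a\<in>set xs. {v, a} \<in> snd G"
    and "\<forall>(a, b)\<in>set (zip xs (rotate1 xs)). a \<noteq> b \<and> {a, b} \<in> snd G"
    and "\<forall>(a, c)\<in>set (zip xs (rotate1 (rotate1 xs))). a \<noteq> c \<and> {a, c} \<notin> snd G"
  shows "\<not> word_representable G"
proof -
  define r where "r i = xs ! (i mod length xs)" for i
  have len: "length xs > 0" using assms(3) by (rule odd_pos)
  then have r_in: "r i \<in> set xs" for i by (simp add: r_def)
  have r_pair: "(r i, r (k + i)) \<in> set (zip xs (rotate k xs))" for i k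
  proof -
    have "zip xs (rotate k xs) ! (i mod length xs) = (r i, r (k + i))"
      using len by (simp add: r_def nth_rotate mod_add_right_eq)
    then show ?thesis
      using len by (metis length_rotate length_zip min.idem mod_less_divisor nth_mem)
  qed
  have edge: "r i \<noteq> r (Suc i) \<and> {r i, r (Suc i)} \<in> snd G" for i
    using assms(6) r_pair[of i 1] by (auto simp: rotate_def)
  have nonedge: "r i \<noteq> r (Suc (Suc i)) \<and> {r i, r (Suc (Suc i))} \<notin> snd G" for i
    using assms(7) r_pair[of i "Suc (Suc 0)"] by (auto simp: rotate_def)
  have "r (length xs) = r 0" "r (Suc (length xs)) = r 1"
    by (simp_all add: r_def mod_Suc)
  then show ?thesis
    using assms(1-5) r_in edge nonedge
    by (intro odd_wheel_not_word_representable[where r = r and n = "length xs" and v = v]) blast+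
qed

theorem theorem4: "\<not> word_representable T1 \<and> \<not> word_representable T2"
proof
  show "\<not> word_representable T1"
    \<comment> \<open>The list contains exactly the neighbours of 5, in rim order; likewise for
      \<open>T2\<close> below.\<close>
    by (rule odd_wheel_list_not_word_representable[where v = 5 and xs = "[2, 4, 7, 8, 6]"])
      (simp_all add: T1_def grid_edges_def doubleton_eq_iff)
  show "\<not> word_representable T2"
    by (rule odd_wheel_list_not_word_representable[where v = 5 and xs = "[1, 2, 3, 6, 9, 8, 4]"])
      (simp_all add: T2_def grid_edges_def doubleton_eq_iff)
qed

end
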